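(* Let $0<\alpha\le 1$ and $T>0$. Let $A$ be a densely defined linear operator on a separable Hilbert space $H$ that is self-adjoint, bounded above with constant $\kappa\ge 0$ (i.e. $\langle Au,u\rangle\le\kappa\|u\|^2$ for all $u\in D(A)$), and has compact resolvent. Then there exists a constant $K\ge 1$, depending only on $A$, $\alpha$, $T$, such that for every $u_T\in H$ and every solution $u$ of the backward problem $\partial_t^\alpha u(t)=Au(t)$, $t\in(0,T)$, $u(T)=u_T$, one has $$\|u(t)\|\le K\,\|u(0)\|^{1-\frac{t}{T}}\,\|u(T)\|^{\frac{t}{T}},\qquad 0\le t\le T.$$ Moreover, if $\kappa=0$, then one can choose $K=1$.
   Context: $(H,\langle\cdot,\cdot\rangle)$ is a separable Hilbert space with norm $\|\cdot\|$. The operator $A:D(A)\subset H\to H$ is densely defined and linear and satisfies: (i) $A$ is self-adjoint; (ii) there is $\kappa\ge 0$ with $\langle Au,u\rangle\le\kappa\|u\|^2$ for all $u\in D(A)$; (iii) there is $\lambda>-\kappa$ such that the resolvent $(\lambda I-A)^{-1}$ exists and is compact. Consequently there is an orthonormal basis $\{\varphi_n\}_{n\in\mathbb{N}}$ of $H$ with $\varphi_n\in D(A)$, $-A\varphi_n=\lambda_n\varphi_n$, and $-\kappa\le\lambda_1\le\lambda_2\le\cdots\to\infty$. The Caputo derivative is $\partial_t^\alpha g(t)=\frac{1}{\Gamma(1-\alpha)}\int_0^t(t-s)^{-\alpha}g'(s)\,ds$ for $0<\alpha<1$ and $\partial_t^1 g=g'$. The Mittag-Leffler function is $E_{\alpha,\beta}(z)=\sum_{k=0}^\infty\frac{z^k}{\Gamma(\alpha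 k+\beta)}$. Solutions: for $u_0\in H$ the solution of $\partial_t^\alpha u=Au$ on $(0,T)$ with $u(0)=u_0$ is $u(t)=\sum_{n=1}^\infty\langle u_0,\varphi_n\rangle E_{\alpha,1}(-\lambda_n t^\alpha)\varphi_n$, $t\in[0,T]$, which lies in $C([0,T];H)$. A solution of the backward problem with final datum $u_T$ is such a function $u$ (for some $u_0=u(0)\in H$) with $u(T)=u_T$; existence for a given $u_T$ is not asserted. *)

theory Defs
  imports "HOL-Analysis.Analysis"
begin

text \<open>
  An unbounded operator is given by its domain D and a function A on the whole type; only the
  values of A on D matter. Scalars are real. A complex Hilbert space is covered through
  its underlying real Hilbert space with inner product Re <x,y>: density, self-adjointness, the form
  bound and compactness of the resolvent carry over, and a complex eigenbasis (f n) yields the real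
  eigenbasis consisting of all f n and i f n, with the same eigenfunction expansions.
\<close>

definition densely_defined_linear :: "'a::real_normed_vector set \<Rightarrow> ('a \<Rightarrow> 'a) \<Rightarrow> bool" where
  "densely_defined_linear D A \<longleftrightarrow>
     subspace D \<and> closure D = UNIV \<and>
     (\<forall>x\<in>D. \<forall>y\<in>D. A (x + y) = A x + A y) \<and>
     (\<forall>c. \<forall>x\<in>D. A (c *\<^sub>R x) = c *\<^sub>R A x)"

definition operator_graph :: "'a set \<Rightarrow> ('a \<Rightarrow> 'a) \<Rightarrow> ('a \<times> 'a) set" where
  "operator_graph D A = {(v, A v) |v. v \<in> D}"

definition adjoint_graph :: "'a::real_inner set \<Rightarrow> ('a \<Rightarrow> 'a) \<Rightarrow> ('a \<times> 'a) set" where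
  "adjoint_graph D A = {(v, w). \<forall>u\<in>D. A u \<bullet> v = u \<bullet> w}"

text \<open>Equality of graphs includes equality of the domains of the operator and its adjoint.\<close>

definition self_adjoint_operator :: "'a::real_inner set \<Rightarrow> ('a \<Rightarrow> 'a) \<Rightarrow> bool" where
  "self_adjoint_operator D A \<longleftrightarrow> adjoint_graph D A = operator_graph D A"

definition compact_map :: "('a::real_normed_vector \<Rightarrow> 'b::real_normed_vector) \<Rightarrow> bool" where
  "compact_map R \<longleftrightarrow> (\<forall>S. bounded S \<longrightarrow> compact (closure (R ` S)))"

definition compact_resolvent_at :: "'a::real_normed_vector set \<Rightarrow> ('a \<Rightarrow> 'a) \<Rightarrow> real \<Rightarrow> bool" where
  "compact_resolvent_at D A l \<longleftrightarrow>
     bij_betw (\<lambda>x. l *\<^sub>R x - A x) D UNIV \<and>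
     compact_map (inv_into D (\<lambda>x. l *\<^sub>R x - A x))"

definition mittag_leffler :: "real \<Rightarrow> real \<Rightarrow> real \<Rightarrow> real" where
  "mittag_leffler \<alpha> \<beta> z = (\<Sum>k. z ^ k / Gamma (\<alpha> * real k + \<beta>))"

text \<open>
  The index set I is UNIV (up to renumbering) when the space is infinite-dimensional and finite
  otherwise. Finiteness of the sublevel sets says that the nondecreasing sequence of eigenvalues
  of -A tends to infinity if I is infinite, and is automatic if I is finite.
\<close>

definition eigenbasis ::
  "'a::real_inner set \<Rightarrow> ('a \<Rightarrow> 'a) \<Rightarrow> nat set \<Rightarrow> (nat \<Rightarrow> 'a) \<Rightarrow> (nat \<Rightarrow> real) \<Rightarrow> bool" where
  "eigenbasis D A I \<phi> \<mu> \<longleftrightarrow>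
     (\<forall>m\<in>I. \<forall>n\<in>I. \<phi> m \<bullet> \<phi> n = (if m = n then 1 else 0)) \<and>
     closure (span (\<phi> ` I)) = UNIV \<and>
     (\<forall>n\<in>I. \<phi> n \<in> D \<and> - A (\<phi> n) = \<mu> n *\<^sub>R \<phi> n) \<and>
     mono_on I \<mu> \<and>
     (\<forall>c. finite {n \<in> I. \<mu> n \<le> c})"

text \<open>
  The solution of the (fractional) evolution equation with generator A and initial value u0 is its
  eigenfunction expansion; its value does not depend on the choice of the eigenbasis. As
  0 powr \<alpha> = 0, the expansion at t = 0 is that of u0. Values of u outside of [0,T] are irrelevant.
\<close>

definition solution ::
  "'a::real_inner set \<Rightarrow> ('a \<Rightarrow> 'a) \<Rightarrow> real \<Rightarrow> real \<Rightarrow> 'a \<Rightarrow> (real \<Rightarrow> 'a) \<Rightarrow> bool" where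
  "solution D A \<alpha> T u0 u \<longleftrightarrow>
     (\<exists>I \<phi> \<mu>. eigenbasis D A I \<phi> \<mu> \<and>
        (\<forall>t\<in>{0..T}. ((\<lambda>n. ((u0 \<bullet> \<phi> n) * mittag_leffler \<alpha> 1 (- \<mu> n * t powr \<alpha>)) *\<^sub>R \<phi> n)
                        has_sum u t) I))"

definition backward_solution ::
  "'a::real_inner set \<Rightarrow> ('a \<Rightarrow> 'a) \<Rightarrow> real \<Rightarrow> real \<Rightarrow> 'a \<Rightarrow> (real \<Rightarrow> 'a) \<Rightarrow> bool" where
  "backward_solution D A \<alpha> T uT u \<longleftrightarrow> (\<exists>u0. solution D A \<alpha> T u0 u) \<and> u T = uT"

end

theory Submission
  imports Defs
begin

text \<open>
  Expanding a solution in the eigenbasis turns the claim into one about the scalar modes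
  \<open>e(t) = E\<^bsub>\<alpha>,1\<^esub>(- \<mu> t\<^sup>\<alpha>)\<close>: if \<open>e(t) \<le> K e(T)\<^bsup>t/T\<^esup>\<close> holds with the same \<open>K\<close> for every eigenvalue,
  then Hoelder's inequality for the sums of squares (\<open>has_sum_interpolation\<close>) gives the bound
  on the norms. The form bound gives \<open>\<mu> \<ge> - \<kappa>\<close>, and \<open>K = E\<^bsub>\<alpha>,1\<^esub>(\<kappa> T\<^sup>\<alpha>)\<close> works: for \<open>\<mu> < 0\<close> the mode lies
  between \<open>1\<close> and \<open>K\<close>, and for \<open>\<kappa> = 0\<close> this \<open>K\<close> equals \<open>1\<close>.

  The substance is the case \<open>\<mu> \<ge> 0\<close>, where one needs
  \<open>E\<^bsub>\<alpha>,1\<^esub>(- y) \<le> E\<^bsub>\<alpha>,1\<^esub>(- x)\<^sup>\<theta>\<close> whenever \<open>0 < \<theta> \<le> 1\<close>, \<open>0 \<le> x\<close> and \<open>\<theta> x \<le> y\<close> (\<open>mittag_leffler_le_powr\<close>).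
  This says that \<open>x \<mapsto> E\<^bsub>\<alpha>,1\<^esub>(- x)\<close> is decreasing, together with the part of its logarithmic convexity
  that involves the base point \<open>0\<close>, where the value is \<open>1\<close>. It is applied with \<open>\<theta> = t/T\<close>, since
  \<open>(t/T)\<^sup>\<alpha> \<ge> t/T\<close>. Both properties are consequences of Pollard's theorem that
  \<open>E\<^bsub>\<alpha>,1\<^esub>(- x)\<close> is completely monotone, but there is a direct way to this inequality.

  Discretise the relaxation equation \<open>\<partial>\<^sub>t\<^sup>\<alpha> w = - \<lambda> w\<close>, \<open>w(0) = 1\<close>, with step \<open>h\<close> by replacing the
  derivative with the backward difference \<open>h\<^bsup>-\<alpha>\<^esup> (1 - shift)\<^sup>\<alpha>\<close>. With \<open>x = \<lambda> h\<^sup>\<alpha>\<close> the scheme reads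
  \<open>(1 + x) w\<^sub>n = \<Sum>\<^sub>i p\<^sub>i w\<^bsub>n-i\<^esub>\<close> plus a multiple of the initial value, where the weights add
  up to \<open>1\<close> and, because \<open>0 < \<alpha> \<le> 1\<close>, are nonnegative. Jensen's inequality for the concave function
  \<open>s \<mapsto> s\<^sup>\<theta>\<close> and \<open>(1 + x)\<^sup>\<theta> \<le> 1 + \<theta> x \<le> 1 + y\<close> give \<open>w\<^sub>n(y) \<le> w\<^sub>n(x)\<^sup>\<theta>\<close> by induction on \<open>n\<close>
  (\<open>discrete_mittag_leffler_le_powr\<close>). On the other hand
  \<open>w\<^sub>n(x) = \<Sum>\<^sub>k (- x)\<^sup>k \<Gamma>(\<alpha> k + 1 + n) / (\<Gamma>(\<alpha> k + 1) n!)\<close>, and by Gauss's limit formula for \<open>\<Gamma>\<close> and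
  Tannery's theorem \<open>w\<^sub>n(x n\<^bsup>-\<alpha>\<^esup>)\<close> tends to \<open>E\<^bsub>\<alpha>,1\<^esub>(- x)\<close> (\<open>discrete_mittag_leffler_LIMSEQ\<close>), so
  the inequality passes to the limit.

  The tangent line bound \<open>y\<^sup>\<theta> \<le> 1 + \<theta> (y - 1)\<close> (\<open>powr_le_affine\<close>) is the only convexity
  input: it yields Jensen's inequality, the step from \<open>(1 + x)\<^sup>\<theta>\<close> to \<open>1 + \<theta> x\<close>, and Hoelder's inequality.
\<close>

section \<open>A tangent line bound and Jensen's inequality for powers\<close>

lemma powr_le_affine:
  fixes y \<theta> :: real
  assumes "0 \<le> y" "0 \<le> \<theta>" "\<theta> \<le> 1"
  shows "y powr \<theta> \<le> 1 + \<theta> * (y - 1)"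
proof (cases "y = 0")
  case False
  then show ?thesis
    using Youngs_inequality_0[of \<theta> "1 - \<theta>" y 1] assms by (simp add: algebra_simps)
qed (use assms in simp)

text \<open>
  With \<open>S\<close> the weighted mean, average the tangent line bounds for \<open>(c i / S) powr \<theta>\<close>: their linear
  terms cancel. This form of the proof allows \<open>c i = 0\<close>.
\<close>

lemma powr_jensen:
  fixes p c :: "'i \<Rightarrow> real" and \<theta> :: real
  assumes "\<And>i. i \<in> I \<Longrightarrow> 0 \<le> p i" "(\<Sum>i\<in>I. p i) = 1" "\<And>i. i \<in> I \<Longrightarrow> 0 \<le> c i"
    and "0 < (\<Sum>i\<in>I. p i * c i)" "0 \<le> \<theta>" "\<theta> \<le> 1"
  shows "(\<Sum>i\<in>I. p i * c i powr \<theta>) \<le> (\<Sum>i\<in>I. p i * c i) powr \<theta>"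
proof -
  define S where "S = (\<Sum>i\<in>I. p i * c i)"
  have S: "S > 0" using assms(4) by (simp add: S_def)
  have "p i * c i powr \<theta> \<le> S powr \<theta> * ((1 - \<theta>) * p i + \<theta> / S * (p i * c i))" if i: "i \<in> I" for i
  proof -
    have "c i powr \<theta> = S powr \<theta> * (c i / S) powr \<theta>"
      using S assms(3)[OF i] by (simp add: powr_divide)
    also have "\<dots> \<le> S powr \<theta> * (1 + \<theta> * (c i / S - 1))"
      using S assms i by (intro mult_left_mono powr_le_affine) auto
    finally have "p i * c i powr \<theta> \<le> p i * (S powr \<theta> * (1 + \<theta> * (c i / S - 1)))"
      using assms(1)[OF i] by (rule mult_left_mono)
    also have "\<dots> = S powr \<theta> * ((1 - \<theta>) * p i + \<theta> / S * (p i * c i))"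
      by (simp add: algebra_simps)
    finally show ?thesis .
  qed
  then have "(\<Sum>i\<in>I. p i * c i powr \<theta>)
      \<le> (\<Sum>i\<in>I. S powr \<theta> * ((1 - \<theta>) * p i + \<theta> / S * (p i * c i)))"
    by (rule sum_mono)
  also have "\<dots> = S powr \<theta> * ((1 - \<theta>) * (\<Sum>i\<in>I. p i) + \<theta> / S * (\<Sum>i\<in>I. p i * c i))"
    by (simp only: sum_distrib_left[symmetric] sum.distrib)
  also have "\<dots> = S powr \<theta>" using S assms(2) by (simp flip: S_def)
  finally show ?thesis by (simp add: S_def)
qed

section \<open>The coefficients of powers of 1/(1 - z)\<close>

text \<open>
  The coefficient of \<open>z\<^sup>n\<close> in \<open>(1 - z)\<^bsup>-a\<^esup>\<close>. For \<open>a \<ge> 0\<close> these are the weights of the fractional sum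
  of order \<open>a\<close>, and for \<open>- 1 \<le> a < 0\<close> those of the fractional difference of order \<open>- a\<close>.
\<close>

definition rising_binomial :: "real \<Rightarrow> nat \<Rightarrow> real" where
  "rising_binomial a n = pochhammer a n / fact n"

lemma rising_binomial_0 [simp]: "rising_binomial a 0 = 1"
  by (simp add: rising_binomial_def)

lemma rising_binomial_1 [simp]: "rising_binomial 1 n = 1"
  by (simp add: rising_binomial_def flip: pochhammer_fact)

lemma rising_binomial_Suc:
  "rising_binomial a (Suc n) = rising_binomial a n * ((a + n) / (n + 1))"
  by (simp add: rising_binomial_def pochhammer_rec' field_simps)

lemma rising_binomial_nonneg: "0 \<le> a \<Longrightarrow> 0 \<le> rising_binomial a n"
  by (induction n) (auto simp: rising_binomial_Suc)

lemma rising_binomial_mono: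
  assumes "0 \<le> a" "a \<le> b"
  shows "rising_binomial a n \<le> rising_binomial b n"
proof (induction n)
  case (Suc n)
  have "(a + n) / (n + 1) \<le> (b + n) / (n + 1)" using assms by (intro divide_right_mono) auto
  with Suc show ?case unfolding rising_binomial_Suc
    using assms by (intro mult_mono) (auto simp: rising_binomial_nonneg)
qed simp

text \<open>
  This sign, which makes every past value enter the scheme below with a nonnegative weight, is where
  the restriction of the order to at most \<open>1\<close> matters.
\<close>

lemma rising_binomial_minus_nonpos:
  assumes "0 < a" "a \<le> 1"
  shows "rising_binomial (- a) (Suc n) \<le> 0"
proof -
  have "pochhammer (- a) (Suc n) = - a * pochhammer (1 - a) n"
    by (simp add: pochhammer_rec)
  moreover have "0 \<le> pochhammer (1 - a) n"
    using assms by (cases "a = 1") (auto simp: pochhammer_0_left intro!: pochhammer_nonneg)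
  ultimately show ?thesis
    using assms by (simp add: rising_binomial_def divide_le_0_iff mult_nonneg_nonneg)
qed

text \<open>
  Vandermonde's identity, that is, \<open>(1 - z)\<^bsup>-(a+b)\<^esup> = (1 - z)\<^bsup>-a\<^esup> (1 - z)\<^bsup>-b\<^esup>\<close> for power series.
\<close>

lemma rising_binomial_add:
  "rising_binomial (a + b) n = (\<Sum>i\<le>n. rising_binomial a i * rising_binomial b (n - i))"
  unfolding rising_binomial_def pochhammer_binomial_sum sum_divide_distrib
proof (rule sum.cong)
  fix i assume "i \<in> {..n}"
  then have "real (n choose i) = fact n / (fact i * fact (n - i))"
    by (simp add: binomial_fact)
  then show "real (n choose i) * pochhammer a i * pochhammer b (n - i) / fact n
      = pochhammer a i / fact i * (pochhammer b (n - i) / fact (n - i))"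
    by simp
qed simp

lemma rising_binomial_swap:
  "rising_binomial (real k + 1) n = rising_binomial (real n + 1) k"
proof -
  have "pochhammer 1 (m + j) = fact m * pochhammer (real m + 1) j" for m j
    by (simp only: pochhammer_product' pochhammer_fact[symmetric] add.commute[of 1])
  from this[of k n] this[of n k]
  have "fact k * pochhammer (real k + 1) n = fact n * pochhammer (real n + 1) k"
    by (simp only: add.commute[of k n])
  then show ?thesis
    by (simp add: rising_binomial_def field_simps)
qed

text \<open>
  For fixed \<open>n\<close> the factor next to \<open>x ^ k\<close> is a polynomial in \<open>k\<close>. Increasing \<open>\<alpha> k\<close> to \<open>k\<close> bounds
  the series by the binomial series of \<open>(1 - \<bar>x\<bar>)\<^bsup>-(n+1)\<^esup>\<close>.
\<close>

lemma summable_rising_binomial_power: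
  fixes x \<alpha> :: real
  assumes "0 \<le> \<alpha>" "\<alpha> \<le> 1" "\<bar>x\<bar> < 1"
  shows "summable (\<lambda>k. \<bar>x ^ k * rising_binomial (\<alpha> * k + 1) n\<bar>)"
proof (rule summable_comparison_test'[where N = 0])
  have "(- (real n + 1) gchoose k) * (- \<bar>x\<bar>) ^ k = rising_binomial (real n + 1) k * \<bar>x\<bar> ^ k" for k
  proof -
    have "(- 1) ^ k * (- \<bar>x\<bar>) ^ k = \<bar>x\<bar> ^ k"
      by (subst power_mult_distrib[symmetric]) simp
    then show ?thesis
      by (simp only: rising_binomial_def gbinomial_pochhammer minus_minus) (simp add: field_simps)
  qed
  then show "summable (\<lambda>k. rising_binomial (real k + 1) n * \<bar>x\<bar> ^ k)"
    using gen_binomial_real[of "- \<bar>x\<bar>" "- (real n + 1)"] assms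
    by (simp add: rising_binomial_swap sums_iff)
next
  fix k :: nat
  have "rising_binomial (\<alpha> * k + 1) n \<le> rising_binomial (real k + 1) n"
    using assms by (intro rising_binomial_mono) (auto simp: mult_left_le_one_le)
  moreover have "0 \<le> rising_binomial (\<alpha> * k + 1) n"
    using assms by (intro rising_binomial_nonneg) auto
  ultimately show "norm \<bar>x ^ k * rising_binomial (\<alpha> * k + 1) n\<bar> \<le> rising_binomial (real k + 1) n * \<bar>x\<bar> ^ k"
    by (simp add: abs_mult power_abs mult.commute mult_left_mono)
qed

section \<open>The discrete Mittag-Leffler function\<close>

text \<open>
  The coefficient of \<open>z\<^sup>n\<close> in \<open>\<Sum>\<^sub>k (- x)\<^sup>k (1 - z)\<^bsup>-\<alpha>k-1\<^esup> = (1 - z)\<^bsup>\<alpha>-1\<^esup> / ((1 - z)\<^sup>\<alpha> + x)\<close>: the analogue of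
  the power series of \<open>E\<^bsub>\<alpha>,1\<^esub>(- x)\<close> in which fractional integrals of the constant \<open>1\<close> are replaced by
  fractional sums.
\<close>

definition discrete_mittag_leffler :: "real \<Rightarrow> real \<Rightarrow> nat \<Rightarrow> real" where
  "discrete_mittag_leffler \<alpha> x n = (\<Sum>k. (- x) ^ k * rising_binomial (\<alpha> * k + 1) n)"

text \<open>
  Index \<open>0\<close> stands for the initial value, index \<open>i > 0\<close> for the value \<open>i\<close> steps ago. The combined
  sequence, given by \<open>history\<close> below, makes a step of the scheme a single convex combination.
\<close>

definition memory_weight :: "real \<Rightarrow> nat \<Rightarrow> nat \<Rightarrow> real" where
  "memory_weight \<alpha> n i =
     (case i of 0 \<Rightarrow> rising_binomial (1 - \<alpha>) n | Suc j \<Rightarrow> - rising_binomial (- \<alpha>) (Suc j))"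

definition history :: "(nat \<Rightarrow> real) \<Rightarrow> nat \<Rightarrow> nat \<Rightarrow> real" where
  "history w n i = (case i of 0 \<Rightarrow> 1 | Suc j \<Rightarrow> w (n - i))"

lemma memory_weight_nonneg:
  assumes "0 < \<alpha>" "\<alpha> \<le> 1"
  shows "0 \<le> memory_weight \<alpha> n i"
proof (cases i)
  case 0
  then show ?thesis using assms by (simp add: memory_weight_def rising_binomial_nonneg)
next
  case (Suc j)
  then show ?thesis
    using rising_binomial_minus_nonpos[OF assms, of j] by (simp add: memory_weight_def)
qed

text \<open>
  Compare coefficients in \<open>((1 - z)\<^sup>\<alpha> + x) W = (1 - z)\<^bsup>\<alpha>-1\<^esup>\<close>, where \<open>W\<close> is the generating function:
  multiplying by \<open>(1 - z)\<^sup>\<alpha>\<close> lowers each exponent by \<open>\<alpha>\<close>, which shifts the series over \<open>k\<close> by one index.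
\<close>

lemma discrete_mittag_leffler_recursion:
  fixes x \<alpha> :: real
  assumes "0 \<le> \<alpha>" "\<alpha> \<le> 1" "\<bar>x\<bar> < 1"
  shows "(1 + x) * discrete_mittag_leffler \<alpha> x n =
    (\<Sum>i\<le>n. memory_weight \<alpha> n i * history (discrete_mittag_leffler \<alpha> x) n i)"
proof -
  let ?w = "discrete_mittag_leffler \<alpha> x"
  let ?r = "\<lambda>m k. (- x) ^ k * rising_binomial (\<alpha> * real k + 1) m"
  have sm: "summable (?r m)" for m
    using assms by (intro summable_rabs_cancel[OF summable_rising_binomial_power]) auto
  have shift: "(\<Sum>i\<le>n. rising_binomial (- \<alpha>) i * ?r (n - i) k)
      = (- x) ^ k * rising_binomial (\<alpha> * (real k - 1) + 1) n" for k
    using rising_binomial_add[of "- \<alpha>" "\<alpha> * real k + 1" n]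
    by (simp add: sum_distrib_left algebra_simps)
  have "(\<Sum>i\<le>n. rising_binomial (- \<alpha>) i * ?w (n - i))
      = (\<Sum>i\<le>n. \<Sum>k. rising_binomial (- \<alpha>) i * ?r (n - i) k)"
    by (simp add: discrete_mittag_leffler_def suminf_mult[OF sm])
  also have "\<dots> = (\<Sum>k. \<Sum>i\<le>n. rising_binomial (- \<alpha>) i * ?r (n - i) k)"
    by (intro suminf_sum[symmetric] summable_mult sm)
  also have "\<dots> = (\<Sum>k. (- x) ^ k * rising_binomial (\<alpha> * (real k - 1) + 1) n)"
    by (simp only: shift)
  also have "\<dots> = rising_binomial (1 - \<alpha>) n + (\<Sum>k. - x * ?r n k)"
  proof -
    have head: "(- x) ^ Suc k * rising_binomial (\<alpha> * (real (Suc k) - 1) + 1) n = - x * ?r n k" for k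
      by simp
    have "summable (\<lambda>k. (- x) ^ k * rising_binomial (\<alpha> * (real k - 1) + 1) n)"
      by (subst summable_Suc_iff[symmetric]) (simp only: head summable_mult sm)
    from suminf_split_head[OF this] show ?thesis by (simp only: head) simp
  qed
  also have "(\<Sum>k. - x * ?r n k) = - x * ?w n"
    by (simp only: discrete_mittag_leffler_def suminf_mult[OF sm])
  finally have "(\<Sum>i\<le>n. rising_binomial (- \<alpha>) i * ?w (n - i)) = rising_binomial (1 - \<alpha>) n - x * ?w n"
    by simp
  then show ?thesis
    by (simp add: sum.atMost_shift memory_weight_def history_def sum_negf algebra_simps)
qed

lemma discrete_mittag_leffler_zero [simp]: "discrete_mittag_leffler \<alpha> 0 n = 1"
  using powser_zero[of "\<lambda>k. rising_binomial (\<alpha> * real k + 1) n"]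
  by (simp add: discrete_mittag_leffler_def mult.commute)

text \<open>
  For \<open>x = 0\<close> the scheme has the constant solution \<open>1\<close>.
\<close>

lemma sum_memory_weight:
  assumes "0 \<le> \<alpha>" "\<alpha> \<le> 1"
  shows "(\<Sum>i\<le>n. memory_weight \<alpha> n i) = 1"
proof -
  have [simp]: "history (discrete_mittag_leffler \<alpha> 0) n = (\<lambda>i. 1)"
    by (auto simp: history_def fun_eq_iff split: nat.splits)
  show ?thesis using discrete_mittag_leffler_recursion[of \<alpha> 0 n] assms by simp
qed

lemma discrete_mittag_leffler_pos:
  assumes "0 < \<alpha>" "\<alpha> \<le> 1" "0 \<le> x" "x < 1"
  shows "0 < discrete_mittag_leffler \<alpha> x n"
proof (induction n rule: less_induct)
  case (less n)
  let ?h = "history (discrete_mittag_leffler \<alpha> x) n"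
  have h: "0 < ?h i" if "i \<le> n" for i
    using less that by (auto simp: history_def split: nat.splits)
  have "\<exists>i\<in>{..n}. memory_weight \<alpha> n i \<noteq> 0"
    using sum_memory_weight[of \<alpha> n] assms by (metis less_imp_le sum.neutral zero_neq_one)
  then obtain i where i: "i \<le> n" "memory_weight \<alpha> n i \<noteq> 0" by auto
  then have "0 < (\<Sum>i\<le>n. memory_weight \<alpha> n i * ?h i)"
    using h[OF i(1)] h memory_weight_nonneg[of \<alpha> n] assms
    by (intro sum_pos2[of _ i]) (auto simp: less_le)
  then show ?case
    using zero_less_mult_pos[of "1 + x" "discrete_mittag_leffler \<alpha> x n"]
      discrete_mittag_leffler_recursion[of \<alpha> x n] assms by auto
qed

text \<open>
  One step of the scheme is a mean of past values divided by \<open>1 + x\<close>. Jensen's inequality carries the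
  bound through the mean, and \<open>(1 + x) powr \<theta> \<le> 1 + \<theta> * x \<le> 1 + y\<close> carries it through the division.
\<close>

lemma discrete_mittag_leffler_le_powr:
  assumes "0 < \<alpha>" "\<alpha> \<le> 1" "0 \<le> x" "x < 1" "y < 1" "0 \<le> \<theta>" "\<theta> \<le> 1" "\<theta> * x \<le> y"
  shows "discrete_mittag_leffler \<alpha> y n \<le> discrete_mittag_leffler \<alpha> x n powr \<theta>"
proof (induction n rule: less_induct)
  case (less n)
  let ?w = "discrete_mittag_leffler \<alpha>"
  let ?p = "memory_weight \<alpha> n"
  have y: "0 \<le> y" using assms mult_nonneg_nonneg[of \<theta> x] by linarith
  have w: "0 < ?w x m" for m using assms by (intro discrete_mittag_leffler_pos)
  have S: "(\<Sum>i\<le>n. ?p i * history (?w x) n i) = (1 + x) * ?w x n"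
    using assms by (simp add: discrete_mittag_leffler_recursion)
  have "(1 + y) * ?w y n = (\<Sum>i\<le>n. ?p i * history (?w y) n i)"
    using assms y by (simp add: discrete_mittag_leffler_recursion)
  also have "\<dots> \<le> (\<Sum>i\<le>n. ?p i * history (?w x) n i powr \<theta>)"
    using less assms
    by (intro sum_mono mult_left_mono memory_weight_nonneg) (auto simp: history_def split: nat.splits)
  also have "\<dots> \<le> (\<Sum>i\<le>n. ?p i * history (?w x) n i) powr \<theta>"
  proof (rule powr_jensen)
    show "0 \<le> history (?w x) n i" for i
      using w by (auto simp: history_def less_imp_le split: nat.splits)
    show "0 < (\<Sum>i\<le>n. ?p i * history (?w x) n i)"
      unfolding S using w assms by (intro mult_pos_pos) auto
  qed (use assms in \<open>auto simp: memory_weight_nonneg sum_memory_weight\<close>)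
  also have "\<dots> = (1 + x) powr \<theta> * ?w x n powr \<theta>"
    using assms w by (simp add: S powr_mult less_imp_le)
  also have "\<dots> \<le> (1 + y) * ?w x n powr \<theta>"
    using powr_le_affine[of "1 + x" \<theta>] assms by (intro mult_right_mono) auto
  finally show ?case using y by simp
qed

section \<open>The limit of vanishing step size\<close>

text \<open>
  For \<open>n > 0\<close> the expression is the reciprocal of the \<open>n\<close>-th Gauss product for \<open>\<Gamma>(a + 1)\<close>.
\<close>

lemma rising_binomial_powr_LIMSEQ:
  assumes "0 \<le> a"
  shows "(\<lambda>n. real n powr (- a) * rising_binomial (a + 1) n) \<longlonglongrightarrow> 1 / Gamma (a + 1)"
proof (rule Lim_transform_eventually)
  have "0 < Gamma (a + 1)" using assms by (intro Gamma_real_pos) simp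
  then show "(\<lambda>n. 1 / Gamma_series' (a + 1) n) \<longlonglongrightarrow> 1 / Gamma (a + 1)"
    by (intro tendsto_divide[OF tendsto_const Gamma_series'_LIMSEQ]) simp
  show "\<forall>\<^sub>F n in sequentially. 1 / Gamma_series' (a + 1) n = real n powr (- a) * rising_binomial (a + 1) n"
    using eventually_gt_at_top[of 0]
  proof eventually_elim
    case (elim n)
    then have fact: "fact n = real n * fact (n - 1)" by (simp add: fact_reduce)
    have "exp ((a + 1) * of_real (ln (real n))) = real n * real n powr a"
      using elim by (simp add: powr_def ring_distribs exp_add mult.commute)
    then show ?case
      using elim by (simp add: Gamma_series'_def rising_binomial_def fact powr_minus divide_inverse)
  qed
qed

text \<open>
  The ratio of consecutive terms is \<open>(1 - s)\<^sup>a (1 + a s)\<close> with \<open>s = 1/(n + 1)\<close>, and the two factors are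
  at most \<open>e\<^bsup>-as\<^esup>\<close> and \<open>e\<^bsup>as\<^esup>\<close>. The monotonicity provides a majorant that is independent of \<open>n\<close>.
\<close>

lemma rising_binomial_powr_antimono:
  assumes "0 \<le> a" "1 \<le> N" "N \<le> n"
  shows "real n powr (- a) * rising_binomial (a + 1) n \<le> real N powr (- a) * rising_binomial (a + 1) N"
  using assms(3)
proof (induction n rule: dec_induct)
  case (step n)
  define s where "s = 1 / (real n + 1)"
  have n: "real n > 0" using step assms by simp
  have "ln (real n / (real n + 1)) \<le> - s"
    using ln_le_minus_one[of "real n / (real n + 1)"] n by (simp add: s_def field_simps)
  then have "a * ln (real n / (real n + 1)) \<le> a * - s" using assms by (intro mult_left_mono)
  then have "(real n / (real n + 1)) powr a \<le> exp (- (a * s))"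
    using n by (simp add: powr_def)
  then have "(real n / (real n + 1)) powr a * (1 + a * s) \<le> exp (- (a * s)) * exp (a * s)"
    using assms by (intro mult_mono exp_ge_add_one_self) (auto simp: s_def)
  then have le1: "(real n / (real n + 1)) powr a * (1 + a * s) \<le> 1" by (simp add: exp_minus)
  have "real (Suc n) powr (- a) = real n powr (- a) * (real n / (real n + 1)) powr a"
    using n by (simp add: powr_divide powr_minus divide_simps add.commute)
  moreover have "rising_binomial (a + 1) (Suc n) = rising_binomial (a + 1) n * (1 + a * s)"
    by (simp add: rising_binomial_Suc s_def divide_simps) (simp add: algebra_simps)
  ultimately have "real (Suc n) powr (- a) * rising_binomial (a + 1) (Suc n)
      = (real n powr (- a) * rising_binomial (a + 1) n) * ((real n / (real n + 1)) powr a * (1 + a * s))"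
    by simp
  also have "\<dots> \<le> real n powr (- a) * rising_binomial (a + 1) n"
    using le1 assms by (intro mult_left_le mult_nonneg_nonneg rising_binomial_nonneg) auto
  finally show ?case using step.IH by linarith
qed simp

lemma scaled_step_LIMSEQ: "0 < \<alpha> \<Longrightarrow> (\<lambda>n. x * real n powr (- \<alpha>)) \<longlonglongrightarrow> 0"
  using tendsto_mult[OF tendsto_const[of x] tendsto_neg_powr[OF _ filterlim_real_sequentially, of "- \<alpha>"]]
  by simp

lemma eventually_step_lt_1:
  "0 < \<alpha> \<Longrightarrow> \<forall>\<^sub>F n in sequentially. x * real n powr (- \<alpha>) < 1"
  using scaled_step_LIMSEQ by (rule order_tendstoD) simp_all

text \<open>
  Termwise convergence is Gauss's limit formula. By monotonicity in \<open>n\<close> the terms at a fixed \<open>N\<close> form a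
  majorant for all \<open>n \<ge> N\<close>; it is summable as soon as \<open>\<bar>x\<bar> N\<^bsup>-\<alpha>\<^esup> < 1\<close>. Tannery's theorem gives
  the limit and also the convergence of the Mittag-Leffler series itself.
\<close>

lemma
  fixes \<alpha> x :: real
  assumes "0 < \<alpha>" "\<alpha> \<le> 1"
  shows abs_summable_mittag_leffler: "summable (\<lambda>k. \<bar>x ^ k / Gamma (\<alpha> * k + 1)\<bar>)"
    and discrete_mittag_leffler_LIMSEQ:
      "(\<lambda>n. discrete_mittag_leffler \<alpha> (- x * real n powr (- \<alpha>)) n) \<longlonglongrightarrow> mittag_leffler \<alpha> 1 x"
proof -
  define a where "a k n = (x * real n powr (- \<alpha>)) ^ k * rising_binomial (\<alpha> * real k + 1) n" for k n
  have a_eq: "a k n = x ^ k * (real n powr (- (\<alpha> * k)) * rising_binomial (\<alpha> * k + 1) n)"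
    if "n \<ge> 1" for k n
    using that by (simp add: a_def power_mult_distrib powr_power mult.commute)
  obtain N where N: "N \<ge> 1" "\<bar>x\<bar> * real N powr (- \<alpha>) < 1"
    using eventually_happens'[OF sequentially_bot
        eventually_conj[OF eventually_ge_at_top[of 1] eventually_step_lt_1[OF assms(1), of "\<bar>x\<bar>"]]]
    by blast
  have lim: "(\<lambda>n. a k n) \<longlonglongrightarrow> x ^ k / Gamma (\<alpha> * k + 1)" for k
  proof (rule Lim_transform_eventually)
    show "(\<lambda>n. x ^ k * (real n powr (- (\<alpha> * k)) * rising_binomial (\<alpha> * k + 1) n))
        \<longlonglongrightarrow> x ^ k / Gamma (\<alpha> * k + 1)"
      using tendsto_mult[OF tendsto_const[of "x ^ k"] rising_binomial_powr_LIMSEQ[of "\<alpha> * k"]] assms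
      by simp
    show "\<forall>\<^sub>F n in sequentially.
        x ^ k * (real n powr (- (\<alpha> * k)) * rising_binomial (\<alpha> * k + 1) n) = a k n"
      using eventually_ge_at_top[of 1] by eventually_elim (rule a_eq[symmetric])
  qed
  have "norm (a k n) \<le> \<bar>a k N\<bar>" if "n \<ge> N" for k n
  proof -
    have "0 \<le> rising_binomial (\<alpha> * k + 1) m" for m
      using assms by (intro rising_binomial_nonneg) auto
    moreover have "real n powr (- (\<alpha> * k)) * rising_binomial (\<alpha> * k + 1) n
        \<le> real N powr (- (\<alpha> * k)) * rising_binomial (\<alpha> * k + 1) N"
      using assms N that by (intro rising_binomial_powr_antimono) auto
    ultimately show ?thesis
      using N that by (simp add: a_eq abs_mult mult_left_mono)
  qed
  then have bound: "\<forall>\<^sub>F (k, n) in at_top \<times>\<^sub>F sequentially. norm (a k n) \<le> \<bar>a k N\<bar>"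
    using eventually_prodI[of "\<lambda>k. True" at_top "\<lambda>n. N \<le> n" sequentially]
    by (auto simp: case_prod_unfold eventually_ge_at_top elim: eventually_mono)
  have "summable (\<lambda>k. \<bar>a k N\<bar>)"
    unfolding a_def using assms N by (intro summable_rising_binomial_power) (auto simp: abs_mult)
  from tannerys_theorem[OF lim bound this]
  have "summable (\<lambda>k. norm (x ^ k / Gamma (\<alpha> * k + 1)))"
    and "(\<lambda>n. \<Sum>k. a k n) \<longlonglongrightarrow> (\<Sum>k. x ^ k / Gamma (\<alpha> * k + 1))"
    by auto
  then show "summable (\<lambda>k. \<bar>x ^ k / Gamma (\<alpha> * k + 1)\<bar>)"
    and "(\<lambda>n. discrete_mittag_leffler \<alpha> (- x * real n powr (- \<alpha>)) n) \<longlonglongrightarrow> mittag_leffler \<alpha> 1 x"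
    by (simp_all add: a_def discrete_mittag_leffler_def mittag_leffler_def)
qed

section \<open>Convexity and positivity of the Mittag-Leffler function\<close>

lemma mittag_leffler_zero [simp]: "mittag_leffler \<alpha> 1 0 = 1"
  using powser_zero[of "\<lambda>k. inverse (Gamma (\<alpha> * real k + 1))"]
  by (simp add: mittag_leffler_def divide_inverse mult.commute)

lemma mittag_leffler_mono:
  assumes "0 < \<alpha>" "\<alpha> \<le> 1" "0 \<le> x" "x \<le> y"
  shows "mittag_leffler \<alpha> 1 x \<le> mittag_leffler \<alpha> 1 y"
  unfolding mittag_leffler_def
proof (rule suminf_le)
  have "summable (\<lambda>k. z ^ k / Gamma (\<alpha> * k + 1))" for z
    by (rule summable_rabs_cancel[OF abs_summable_mittag_leffler[OF assms(1,2)]])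
  then show "summable (\<lambda>k. x ^ k / Gamma (\<alpha> * k + 1))" "summable (\<lambda>k. y ^ k / Gamma (\<alpha> * k + 1))"
    by blast+
  show "x ^ k / Gamma (\<alpha> * k + 1) \<le> y ^ k / Gamma (\<alpha> * k + 1)" for k
    using assms by (intro divide_right_mono power_mono less_imp_le[OF Gamma_real_pos]) (auto intro: add_nonneg_pos)
qed

lemma mittag_leffler_nonneg:
  assumes "0 < \<alpha>" "\<alpha> \<le> 1" "0 \<le> x"
  shows "0 \<le> mittag_leffler \<alpha> 1 (- x)"
proof (rule tendsto_lowerbound)
  show "(\<lambda>n. discrete_mittag_leffler \<alpha> (x * real n powr (- \<alpha>)) n) \<longlonglongrightarrow> mittag_leffler \<alpha> 1 (- x)"
    using discrete_mittag_leffler_LIMSEQ[OF assms(1,2), of "- x"] by simp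
  show "\<forall>\<^sub>F n in sequentially. 0 \<le> discrete_mittag_leffler \<alpha> (x * real n powr (- \<alpha>)) n"
    using eventually_step_lt_1[OF assms(1), of x]
    by eventually_elim (use assms in \<open>auto intro!: less_imp_le[OF discrete_mittag_leffler_pos]\<close>)
qed simp

lemma mittag_leffler_le_powr:
  assumes "0 < \<alpha>" "\<alpha> \<le> 1" "0 \<le> x" "0 < \<theta>" "\<theta> \<le> 1" "\<theta> * x \<le> y"
  shows "mittag_leffler \<alpha> 1 (- y) \<le> mittag_leffler \<alpha> 1 (- x) powr \<theta>"
proof (rule tendsto_le)
  let ?w = "\<lambda>z n. discrete_mittag_leffler \<alpha> (z * real n powr (- \<alpha>)) n"
  note small = eventually_step_lt_1[OF assms(1)]
  show "(\<lambda>n. ?w y n) \<longlonglongrightarrow> mittag_leffler \<alpha> 1 (- y)"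
    using discrete_mittag_leffler_LIMSEQ[OF assms(1,2), of "- y"] by simp
  have "\<forall>\<^sub>F n in sequentially. 0 \<le> ?w x n"
    using small[of x] by eventually_elim (use assms in \<open>auto intro!: less_imp_le[OF discrete_mittag_leffler_pos]\<close>)
  then show "(\<lambda>n. ?w x n powr \<theta>) \<longlonglongrightarrow> mittag_leffler \<alpha> 1 (- x) powr \<theta>"
    using discrete_mittag_leffler_LIMSEQ[OF assms(1,2), of "- x"] assms
    by (intro tendsto_powr') auto
  show "\<forall>\<^sub>F n in sequentially. ?w y n \<le> ?w x n powr \<theta>"
    using small[of x] small[of y]
  proof eventually_elim
    case (elim n)
    have "\<theta> * x * real n powr (- \<alpha>) \<le> y * real n powr (- \<alpha>)"
      using assms by (intro mult_right_mono) auto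
    then show ?case
      using elim assms by (intro discrete_mittag_leffler_le_powr) (auto simp: mult.assoc)
  qed
qed simp

text \<open>
  A zero at \<open>x < 0\<close> would, by the power bound with \<open>\<theta> = 1/(n+1)\<close>, force values \<open>\<le> 0\<close> at the
  points \<open>x/(n+1)\<close>, against continuity and the value \<open>1\<close> at \<open>0\<close>.
\<close>

lemma mittag_leffler_pos:
  assumes "0 < \<alpha>" "\<alpha> \<le> 1"
  shows "0 < mittag_leffler \<alpha> 1 x"
proof (cases "0 \<le> x")
  case True
  then show ?thesis using mittag_leffler_mono[OF assms order_refl True] by simp
next
  case False
  show ?thesis
  proof (rule ccontr)
    assume neg: "\<not> 0 < mittag_leffler \<alpha> 1 x"
    have "0 \<le> mittag_leffler \<alpha> 1 x"
      using mittag_leffler_nonneg[OF assms, of "- x"] False by simp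
    with neg have zero: "mittag_leffler \<alpha> 1 x = 0" by simp
    have le: "mittag_leffler \<alpha> 1 (x * (1 / real (Suc n))) \<le> 0" for n
      using mittag_leffler_le_powr[OF assms, of "- x" "1 / real (Suc n)" "- x * (1 / real (Suc n))"] False
      by (simp add: zero divide_le_0_iff)
    have "summable (\<lambda>k. inverse (Gamma (\<alpha> * real k + 1)) * z ^ k)" for z
      using summable_rabs_cancel[OF abs_summable_mittag_leffler[OF assms, of z]]
      by (simp add: divide_inverse mult.commute)
    then have "isCont (\<lambda>z. \<Sum>k. inverse (Gamma (\<alpha> * real k + 1)) * z ^ k) 0"
      by (rule isCont_powser_converges_everywhere)
    then have "isCont (mittag_leffler \<alpha> 1) 0"
      by (simp add: mittag_leffler_def[abs_def] divide_inverse mult.commute)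
    moreover have "(\<lambda>n. x * (1 / real (Suc n))) \<longlonglongrightarrow> 0"
      using tendsto_mult[OF tendsto_const[of x] LIMSEQ_inverse_real_of_nat] by (simp add: divide_inverse)
    ultimately have "(\<lambda>n. mittag_leffler \<alpha> 1 (x * (1 / real (Suc n)))) \<longlonglongrightarrow> mittag_leffler \<alpha> 1 0"
      by (rule isCont_tendsto_compose)
    then have "mittag_leffler \<alpha> 1 0 \<le> 0"
      by (rule LIMSEQ_le_const2) (use le in blast)
    then show False by simp
  qed
qed

text \<open>
  For \<open>\<mu> \<ge> 0\<close> the power bound applies with constant \<open>1\<close>, as \<open>t/T \<le> (t/T) powr \<alpha>\<close>. For \<open>\<mu> < 0\<close> the mode
  is increasing in time, so its value at \<open>t\<close> is below the constant and its value at \<open>T\<close> is at least \<open>1\<close>.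
\<close>

lemma mittag_leffler_mode_interpolation:
  assumes "0 < \<alpha>" "\<alpha> \<le> 1" "- \<kappa> \<le> \<mu>" "0 \<le> \<kappa>" "0 < t" "t \<le> T"
  shows "mittag_leffler \<alpha> 1 (- \<mu> * t powr \<alpha>)
    \<le> mittag_leffler \<alpha> 1 (\<kappa> * T powr \<alpha>) * mittag_leffler \<alpha> 1 (- \<mu> * T powr \<alpha>) powr (t / T)"
proof (cases "0 \<le> \<mu>")
  case True
  have "t / T = (t / T) powr 1" using assms by simp
  also have "\<dots> \<le> (t / T) powr \<alpha>" using assms by (intro powr_mono') auto
  finally have "t / T * (\<mu> * T powr \<alpha>) \<le> (t / T) powr \<alpha> * (\<mu> * T powr \<alpha>)"
    using True by (intro mult_right_mono) auto
  also have "\<dots> = \<mu> * t powr \<alpha>" using assms by (simp add: powr_divide)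
  finally have "mittag_leffler \<alpha> 1 (- \<mu> * t powr \<alpha>) \<le> mittag_leffler \<alpha> 1 (- \<mu> * T powr \<alpha>) powr (t / T)"
    using mittag_leffler_le_powr[OF assms(1,2), of "\<mu> * T powr \<alpha>" "t / T" "\<mu> * t powr \<alpha>"] True assms
    by simp
  moreover have "1 \<le> mittag_leffler \<alpha> 1 (\<kappa> * T powr \<alpha>)"
    using mittag_leffler_mono[OF assms(1,2), of 0 "\<kappa> * T powr \<alpha>"] assms by simp
  then have "1 * mittag_leffler \<alpha> 1 (- \<mu> * T powr \<alpha>) powr (t / T)
      \<le> mittag_leffler \<alpha> 1 (\<kappa> * T powr \<alpha>) * mittag_leffler \<alpha> 1 (- \<mu> * T powr \<alpha>) powr (t / T)"
    by (rule mult_right_mono) simp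
  ultimately show ?thesis by linarith
next
  case False
  have "t powr \<alpha> \<le> T powr \<alpha>" using assms by (intro powr_mono2) auto
  then have "- \<mu> * t powr \<alpha> \<le> \<kappa> * T powr \<alpha>" using assms False by (intro mult_mono) auto
  then have "mittag_leffler \<alpha> 1 (- \<mu> * t powr \<alpha>) \<le> mittag_leffler \<alpha> 1 (\<kappa> * T powr \<alpha>)"
    using False assms by (intro mittag_leffler_mono) (auto simp: mult_nonpos_nonneg)
  moreover have "1 \<le> mittag_leffler \<alpha> 1 (- \<mu> * T powr \<alpha>)"
    using mittag_leffler_mono[OF assms(1,2), of 0 "- \<mu> * T powr \<alpha>"] False by (simp add: mult_nonpos_nonneg)
  then have "1 \<le> mittag_leffler \<alpha> 1 (- \<mu> * T powr \<alpha>) powr (t / T)"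
    using assms by (intro ge_one_powr_ge_zero) auto
  then have "mittag_leffler \<alpha> 1 (\<kappa> * T powr \<alpha>) * 1
      \<le> mittag_leffler \<alpha> 1 (\<kappa> * T powr \<alpha>) * mittag_leffler \<alpha> 1 (- \<mu> * T powr \<alpha>) powr (t / T)"
    using mittag_leffler_pos[OF assms(1,2), of "\<kappa> * T powr \<alpha>"] by (intro mult_left_mono) auto
  ultimately show ?thesis by linarith
qed

section \<open>Interpolation of eigenfunction expansions\<close>

lemma has_sum_member_le:
  fixes f :: "'i \<Rightarrow> real"
  assumes "(f has_sum S) I" "\<And>n. n \<in> I \<Longrightarrow> 0 \<le> f n" "n \<in> I"
  shows "f n \<le> S"
  using has_sum_mono'[OF has_sum_finite[of "{n}" f] assms(1)] assms(2,3) by simp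

text \<open>
  Hoelder's inequality with the measure \<open>a\<close>. As \<open>v\<close> is positive, \<open>A\<close> and \<open>B\<close> are positive unless all
  \<open>a n\<close> vanish; the tangent line bound for \<open>(v n * A / B) powr \<theta>\<close> can then be summed, and its
  linear term sums to zero.
\<close>

lemma has_sum_interpolation:
  fixes a v w :: "'i \<Rightarrow> real"
  assumes A: "(a has_sum A) I" and B: "((\<lambda>n. a n * v n) has_sum B) I" and C: "((\<lambda>n. a n * w n) has_sum C) I"
    and a: "\<And>n. n \<in> I \<Longrightarrow> 0 \<le> a n" and v: "\<And>n. n \<in> I \<Longrightarrow> 0 < v n"
    and w: "\<And>n. n \<in> I \<Longrightarrow> w n \<le> M * v n powr \<theta>"
    and "0 \<le> M" "0 \<le> \<theta>" "\<theta> \<le> 1"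
  shows "C \<le> M * A powr (1 - \<theta>) * B powr \<theta>"
proof (cases "\<exists>n\<in>I. a n \<noteq> 0")
  case False
  then have "((\<lambda>n. a n * w n) has_sum 0) I" by (intro has_sum_0) auto
  with C have "C = 0" by (rule has_sum_unique)
  then show ?thesis using assms by simp
next
  case True
  then obtain m where m: "m \<in> I" "0 < a m" using a by (metis less_le)
  have "a m \<le> A" "a m * v m \<le> B"
    using m a v by (auto intro!: has_sum_member_le[OF A] has_sum_member_le[OF B] simp: less_imp_le)
  moreover have "0 < a m * v m" using m v by simp
  ultimately have pos: "0 < A" "0 < B" using m by linarith+
  define R where "R = M * (B / A) powr \<theta>"
  have "0 \<le> R" using assms by (simp add: R_def)
  have "C \<le> R * ((1 - \<theta>) * A + \<theta> * A / B * B)"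
  proof (rule has_sum_mono[OF C])
    show "((\<lambda>n. R * ((1 - \<theta>) * a n + \<theta> * A / B * (a n * v n)))
        has_sum R * ((1 - \<theta>) * A + \<theta> * A / B * B)) I"
      by (intro has_sum_cmult_right has_sum_add A B)
  next
    fix n assume n: "n \<in> I"
    have "v n powr \<theta> = (B / A) powr \<theta> * (v n * A / B) powr \<theta>"
      using pos v[OF n] by (simp flip: powr_mult)
    also have "\<dots> \<le> (B / A) powr \<theta> * (1 + \<theta> * (v n * A / B - 1))"
      using pos v[OF n] assms by (intro mult_left_mono powr_le_affine) auto
    finally have "M * v n powr \<theta> \<le> R * (1 + \<theta> * (v n * A / B - 1))"
      using assms by (simp add: R_def mult.assoc mult_left_mono)
    then have "a n * w n \<le> a n * (R * (1 + \<theta> * (v n * A / B - 1)))"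
      using w[OF n] a[OF n] by (intro mult_left_mono) auto
    also have "\<dots> = R * ((1 - \<theta>) * a n + \<theta> * A / B * (a n * v n))"
      by (simp add: algebra_simps)
    finally show "a n * w n \<le> R * ((1 - \<theta>) * a n + \<theta> * A / B * (a n * v n))" .
  qed
  also have "\<dots> = R * A" using pos by (simp add: algebra_simps)
  also have "\<dots> = M * A powr (1 - \<theta>) * B powr \<theta>"
    using pos by (simp add: R_def powr_divide powr_diff)
  finally show ?thesis .
qed

text \<open>
  One half of Parseval's identity: the expansion is assumed to converge to \<open>u\<close>, so orthonormality
  suffices.
\<close>

lemma has_sum_norm_square:
  fixes \<phi> :: "'i \<Rightarrow> 'a::real_inner"
  assumes "\<And>m n. m \<in> I \<Longrightarrow> n \<in> I \<Longrightarrow> \<phi> m \<bullet> \<phi> n = (if m = n then 1 else 0)"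
    and u: "((\<lambda>n. c n *\<^sub>R \<phi> n) has_sum u) I"
  shows "((\<lambda>n. (c n)\<^sup>2) has_sum (norm u)\<^sup>2) I"
proof -
  have coeff: "u \<bullet> \<phi> m = c m" if m: "m \<in> I" for m
  proof -
    have "((\<lambda>n. (c n *\<^sub>R \<phi> n) \<bullet> \<phi> m) has_sum u \<bullet> \<phi> m) I"
      by (rule has_sum_bounded_linear[OF bounded_linear_inner_left u])
    moreover have "((\<lambda>n. (c n *\<^sub>R \<phi> n) \<bullet> \<phi> m) has_sum c m) I"
      using has_sum_finite_neutralI[of "{m}" I "\<lambda>n. (c n *\<^sub>R \<phi> n) \<bullet> \<phi> m"] m assms(1) by auto
    ultimately show ?thesis by (rule has_sum_unique)
  qed
  have "((\<lambda>n. u \<bullet> (c n *\<^sub>R \<phi> n)) has_sum u \<bullet> u) I"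
    by (rule has_sum_bounded_linear[OF bounded_linear_inner_right u])
  also have "?this \<longleftrightarrow> ((\<lambda>n. (c n)\<^sup>2) has_sum u \<bullet> u) I"
    by (rule has_sum_cong) (simp add: coeff power2_eq_square)
  finally show ?thesis by (simp add: power2_norm_eq_inner)
qed

lemma eigenbasis_lower_bound:
  assumes "eigenbasis D A I \<phi> \<mu>" "\<forall>u\<in>D. A u \<bullet> u \<le> \<kappa> * (norm u)\<^sup>2" "n \<in> I"
  shows "- \<kappa> \<le> \<mu> n"
proof -
  have n: "\<phi> n \<bullet> \<phi> n = 1" "\<phi> n \<in> D" and "- A (\<phi> n) = \<mu> n *\<^sub>R \<phi> n"
    using assms by (auto simp: eigenbasis_def)
  then have "A (\<phi> n) = - (\<mu> n *\<^sub>R \<phi> n)" by (metis minus_minus)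
  have "A (\<phi> n) \<bullet> \<phi> n \<le> \<kappa> * (norm (\<phi> n))\<^sup>2" using assms(2) n(2) by blast
  with n \<open>A (\<phi> n) = _\<close> show ?thesis by (simp add: power2_norm_eq_inner)
qed

text \<open>
  Parseval's identity expresses the squared norms as sums with the weights \<open>(u0 \<bullet> \<phi> n)\<^sup>2\<close>, at time
  \<open>0\<close> with all modes equal to \<open>1\<close>; the inequality for each mode then enters Hoelder's
  inequality.
\<close>

lemma solution_interpolation:
  assumes "0 < \<alpha>" "\<alpha> \<le> 1" "0 \<le> \<kappa>" and form: "\<forall>u\<in>D. A u \<bullet> u \<le> \<kappa> * (norm u)\<^sup>2"
    and sol: "solution D A \<alpha> T u0 u" and "T > 0" and t: "t \<in> {0..T}"
  shows "norm (u t) \<le> mittag_leffler \<alpha> 1 (\<kappa> * T powr \<alpha>)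
    * norm (u 0) powr (1 - t / T) * norm (u T) powr (t / T)"
proof -
  from sol obtain I \<phi> \<mu> where basis: "eigenbasis D A I \<phi> \<mu>"
    and exp: "\<And>s. s \<in> {0..T} \<Longrightarrow>
      ((\<lambda>n. ((u0 \<bullet> \<phi> n) * mittag_leffler \<alpha> 1 (- \<mu> n * s powr \<alpha>)) *\<^sub>R \<phi> n) has_sum u s) I"
    unfolding solution_def by blast
  define e where "e n s = mittag_leffler \<alpha> 1 (- \<mu> n * s powr \<alpha>)" for n s
  define K where "K = mittag_leffler \<alpha> 1 (\<kappa> * T powr \<alpha>)"
  let ?\<theta> = "t / T"
  have e: "0 < e n s" for n s unfolding e_def by (rule mittag_leffler_pos[OF assms(1,2)])
  have K: "1 \<le> K"
    using mittag_leffler_mono[OF assms(1,2), of 0 "\<kappa> * T powr \<alpha>"] assms by (simp add: K_def)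
  have norms: "((\<lambda>n. (u0 \<bullet> \<phi> n)\<^sup>2 * (e n s)\<^sup>2) has_sum (norm (u s))\<^sup>2) I" if "s \<in> {0..T}" for s
    using has_sum_norm_square[OF _ exp[OF that]] basis
    by (simp add: e_def power_mult_distrib eigenbasis_def)
  have "(norm (u t))\<^sup>2 \<le> K\<^sup>2 * ((norm (u 0))\<^sup>2) powr (1 - ?\<theta>) * ((norm (u T))\<^sup>2) powr ?\<theta>"
  proof (rule has_sum_interpolation[OF _ norms norms[OF t]])
    show "((\<lambda>n. (u0 \<bullet> \<phi> n)\<^sup>2) has_sum (norm (u 0))\<^sup>2) I"
      using norms[of 0] assms by (simp add: e_def)
    show "(e n t)\<^sup>2 \<le> K\<^sup>2 * (e n T)\<^sup>2 powr ?\<theta>" if "n \<in> I" for n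
    proof -
      have "e n t \<le> K * e n T powr ?\<theta>"
        \<comment> \<open>At \<open>t = 0\<close> the right-hand side is \<open>K\<close> only because the mode at \<open>T\<close> is nonzero.\<close>
      proof (cases "t = 0")
        case True
        then show ?thesis using K e[of n T] by (simp add: e_def)
      next
        case False
        then show ?thesis
          unfolding e_def K_def using assms eigenbasis_lower_bound[OF basis form that]
          by (intro mittag_leffler_mode_interpolation) auto
      qed
      then have "(e n t)\<^sup>2 \<le> (K * e n T powr ?\<theta>)\<^sup>2"
        using e[of n t] by (intro power_mono) auto
      then show ?thesis
        by (simp add: power_mult_distrib power2_eq_square powr_mult mult_ac)
    qed
    show "0 < (e n T)\<^sup>2" for n using e[of n T] by simp
  qed (use assms in auto)
  also have "\<dots> = (K * norm (u 0) powr (1 - ?\<theta>) * norm (u T) powr ?\<theta>)\<^sup>2"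
    by (simp add: power_mult_distrib power2_eq_square powr_mult mult_ac)
  finally show ?thesis
    unfolding K_def[symmetric] by (rule power2_le_imp_le) (use K in simp)
qed

theorem theorem1p1:
  fixes D :: "'a::{real_inner, complete_space} set"
    and A :: "'a \<Rightarrow> 'a"
    and \<alpha> T \<kappa> :: real
  assumes "separable_space (euclidean :: 'a topology)"
    and "0 < \<alpha>" and "\<alpha> \<le> 1" and "T > 0"
    and "densely_defined_linear D A"
    and "self_adjoint_operator D A"
    and "\<kappa> \<ge> 0" and "\<forall>u\<in>D. A u \<bullet> u \<le> \<kappa> * (norm u)\<^sup>2"
    and "\<exists>l>-\<kappa>. compact_resolvent_at D A l"
  shows "\<exists>K\<ge>1. (\<kappa> = 0 \<longrightarrow> K = 1) \<and>
    (\<forall>uT u. backward_solution D A \<alpha> T uT u \<longrightarrow>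
       (\<forall>t\<in>{0..T}. norm (u t) \<le> K * norm (u 0) powr (1 - t / T) * norm (u T) powr (t / T)))"
proof (intro exI conjI impI allI ballI)
  let ?K = "mittag_leffler \<alpha> 1 (\<kappa> * T powr \<alpha>)"
  show "1 \<le> ?K"
    using mittag_leffler_mono[of \<alpha> 0 "\<kappa> * T powr \<alpha>"] assms by simp
  show "?K = 1" if "\<kappa> = 0" using that by simp
  fix uT u t
  assume "backward_solution D A \<alpha> T uT u" and t: "t \<in> {0..T}"
  then obtain u0 where "solution D A \<alpha> T u0 u" by (auto simp: backward_solution_def)
  then show "norm (u t) \<le> ?K * norm (u 0) powr (1 - t / T) * norm (u T) powr (t / T)"
    by (rule solution_interpolation[OF assms(2,3,7,8) _ assms(4) t])
qed

end
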